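(* Let $T$ be a locally finite tree with a fixed root at infinity $\omega\in\partial T$, in which every vertex has at least one successor, and let $m$ be a flow measure on $T$. Let $\tilde\sigma:\mathbb Z\to(0,\infty)$ be a positive weight with $\sum_{n\le 0}\tilde\sigma(n)=\infty$. Let $f$ be harmonic on $T$ and suppose that $f\in L^p(m\cdot\tilde\sigma)$ for some $p\in[1,\infty)$. Then $f=0$ on $T$.
   Context: Tree notation. $T$ is an infinite locally finite tree with graph distance $d$ and a fixed reference vertex $o$. The boundary $\partial T$ is the set of equivalence classes of infinite geodesics starting at $o$ (two being equivalent if they eventually coincide). Fix $\omega\in\partial T$; let $[o,\omega)=\{x_n\}_{n\ge0}$ be the geodesic ray from $o$ (with $x_0=o$) representing $\omega$. The level is $\ell(x)=\lim_{n\to\infty}(n-d(x,x_n))$. For each vertex $x$, $p(x)$ is the unique neighbour with $\ell(p(x))=\ell(x)+1$, and $s(x)$ is the set of the other neighbours (successors). It is assumed that $s(x)\neq\emptyset$ for all $x$. A flow measure is a function $m:T\to(0,\infty)$ with $m(x)=\sum_{y\in s(x)}m(y)$ for all $x$. The associated forward Laplacian is $\Delta f(x)=f(x)-\sum_{y\in s(x)}f(y)\frac{m(y)}{m(x)}$; $f:T\to\mathbb C$ is harmonic if $\Delta f=0$ on $T$. $m\cdot\tilde\sigma$ is the measure on $T$ giving mass $m(x)\tilde\sigma(\ell(x))$ to the vertex $x$. *)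

theory Defs
  imports "HOL-Analysis.Analysis"
begin

text \<open>
  A graph is a set of edges \<open>E :: ('a \<times> 'a) set\<close>, each edge being present in both
  orientations; its vertex set is the whole type \<open>'a\<close>.
\<close>

definition simple_graph :: "('a \<times> 'a) set \<Rightarrow> bool" where
  "simple_graph E \<longleftrightarrow> sym E \<and> irrefl E"

definition is_cycle :: "('a \<times> 'a) set \<Rightarrow> 'a list \<Rightarrow> bool" where
  "is_cycle E xs \<longleftrightarrow> length xs \<ge> 3 \<and> distinct xs \<and>
     successively (\<lambda>x y. (x, y) \<in> E) xs \<and> (last xs, hd xs) \<in> E"

definition tree :: "('a \<times> 'a) set \<Rightarrow> bool" where
  "tree E \<longleftrightarrow> simple_graph E \<and> (\<forall>x y. (x, y) \<in> E\<^sup>*) \<and> (\<nexists>xs. is_cycle E xs)"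

definition locally_finite :: "('a \<times> 'a) set \<Rightarrow> bool" where
  "locally_finite E \<longleftrightarrow> (\<forall>x. finite {y. (x, y) \<in> E})"

definition graph_dist :: "('a \<times> 'a) set \<Rightarrow> 'a \<Rightarrow> 'a \<Rightarrow> nat" where
  "graph_dist E x y = (LEAST n. (x, y) \<in> E ^^ n)"

definition geodesic_rays :: "('a \<times> 'a) set \<Rightarrow> 'a \<Rightarrow> (nat \<Rightarrow> 'a) set" where
  "geodesic_rays E o' = {\<xi>. \<xi> 0 = o' \<and> (\<forall>i j. i \<le> j \<longrightarrow> graph_dist E (\<xi> i) (\<xi> j) = j - i)}"

text \<open>
  All rays start at \<open>o'\<close> and are parametrised by the distance to \<open>o'\<close>, so two of them
  eventually coincide (as paths) precisely when they agree at all large times, without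
  any shift of the parameter.
\<close>

definition eventually_coincide :: "('a \<times> 'a) set \<Rightarrow> 'a \<Rightarrow> ((nat \<Rightarrow> 'a) \<times> (nat \<Rightarrow> 'a)) set" where
  "eventually_coincide E o' = {(\<xi>, \<eta>). \<xi> \<in> geodesic_rays E o' \<and> \<eta> \<in> geodesic_rays E o' \<and>
     (\<forall>\<^sub>F n in sequentially. \<xi> n = \<eta> n)}"

definition boundary :: "('a \<times> 'a) set \<Rightarrow> 'a \<Rightarrow> (nat \<Rightarrow> 'a) set set" where
  "boundary E o' = geodesic_rays E o' // eventually_coincide E o'"

text \<open>In a tree, every boundary point has exactly one representative starting at \<open>o'\<close>.\<close>

definition ray :: "(nat \<Rightarrow> 'a) set \<Rightarrow> nat \<Rightarrow> 'a" where
  "ray \<omega> = (THE \<xi>. \<xi> \<in> \<omega>)"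

text \<open>The limit is taken in the discrete space \<open>int\<close>: in a tree the sequence is eventually constant.\<close>

definition level :: "('a \<times> 'a) set \<Rightarrow> (nat \<Rightarrow> 'a) set \<Rightarrow> 'a \<Rightarrow> int" where
  "level E \<omega> x = lim (\<lambda>n. int n - int (graph_dist E x (ray \<omega> n)))"

definition predecessor :: "('a \<times> 'a) set \<Rightarrow> (nat \<Rightarrow> 'a) set \<Rightarrow> 'a \<Rightarrow> 'a" where
  "predecessor E \<omega> x = (THE y. (x, y) \<in> E \<and> level E \<omega> y = level E \<omega> x + 1)"

definition successors :: "('a \<times> 'a) set \<Rightarrow> (nat \<Rightarrow> 'a) set \<Rightarrow> 'a \<Rightarrow> 'a set" where
  "successors E \<omega> x = {y. (x, y) \<in> E \<and> y \<noteq> predecessor E \<omega> x}"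

definition flow_measure :: "('a \<times> 'a) set \<Rightarrow> (nat \<Rightarrow> 'a) set \<Rightarrow> ('a \<Rightarrow> real) \<Rightarrow> bool" where
  "flow_measure E \<omega> m \<longleftrightarrow>
     (\<forall>x. m x > 0) \<and> (\<forall>x. m x = (\<Sum>y\<in>successors E \<omega> x. m y))"

definition laplacian ::
  "('a \<times> 'a) set \<Rightarrow> (nat \<Rightarrow> 'a) set \<Rightarrow> ('a \<Rightarrow> real) \<Rightarrow> ('a \<Rightarrow> complex) \<Rightarrow> 'a \<Rightarrow> complex" where
  "laplacian E \<omega> m f x = f x - (\<Sum>y\<in>successors E \<omega> x. f y * of_real (m y / m x))"

definition harmonic ::
  "('a \<times> 'a) set \<Rightarrow> (nat \<Rightarrow> 'a) set \<Rightarrow> ('a \<Rightarrow> real) \<Rightarrow> ('a \<Rightarrow> complex) \<Rightarrow> bool" where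
  "harmonic E \<omega> m f \<longleftrightarrow> (\<forall>x. laplacian E \<omega> m f x = 0)"

definition weighted_measure ::
  "('a \<times> 'a) set \<Rightarrow> (nat \<Rightarrow> 'a) set \<Rightarrow> ('a \<Rightarrow> real) \<Rightarrow> (int \<Rightarrow> real) \<Rightarrow> 'a measure" where
  "weighted_measure E \<omega> m \<sigma> = point_measure UNIV (\<lambda>x. ennreal (m x * \<sigma> (level E \<omega> x)))"

definition Lp :: "real \<Rightarrow> 'a measure \<Rightarrow> ('a \<Rightarrow> complex) set" where
  "Lp p M = {f. f \<in> borel_measurable M \<and> integrable M (\<lambda>x. norm (f x) powr p)}"

end

theory Submission
  imports Defs
begin

text \<open>
  Harmonicity says that \<open>f x\<close> is the \<open>m\<close>-weighted mean of \<open>f\<close> over the successors of \<open>x\<close>.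
  By Jensen's inequality for \<open>t \<mapsto> t powr p\<close>, the function \<open>h y = m y * norm (f y) powr p\<close>
  satisfies \<open>h x \<le> (\<Sum>y\<in>s(x). h y)\<close> (\<open>harmonic_norm_powr_submean\<close>). Iterating this, \<open>h x\<close> is
  at most the sum of \<open>h\<close> over the \<open>n\<close>-th generation of descendants of \<open>x\<close>, for every \<open>n\<close>. That
  generation lies entirely on the level \<open>\<ell>(x) - n\<close>, where the weight is \<open>\<sigma> (\<ell>(x) - n)\<close>, and
  generations are pairwise disjoint. Adding up over \<open>n\<close> (\<open>weighted_generations_le_infsum\<close>),
  \[ h(x) \sum_{n \ge 0} \sigma(\ell(x) - n) \le \|f\|_p^p < \infty . \]
  The sum on the left diverges, since it differs from the divergent \<open>\<Sum>n\<le>0. \<sigma> n\<close> only in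
  finitely many terms; hence \<open>h x = 0\<close>.

  The iteration uses that the sets of successors of distinct vertices are disjoint and that
  successors lie exactly one level below. Both follow from the fact that, whatever vertex \<open>r\<close> is
  chosen, a neighbour of \<open>x\<close> is never at the same distance from \<open>r\<close> as \<open>x\<close>, and at most one
  neighbour is closer (\<open>graph_dist_neighbour_neq\<close>, \<open>closer_neighbour_unique\<close>). Letting \<open>r\<close> move
  along the ray to \<open>\<omega>\<close> turns this into a statement about levels.
\<close>

section \<open>Distances in a tree\<close>

lemma tree_sym: "tree E \<Longrightarrow> (x, y) \<in> E \<Longrightarrow> (y, x) \<in> E"
  by (auto simp: tree_def simple_graph_def dest: symD)

lemma relpow_graph_dist:
  assumes "tree E"
  shows "(x, y) \<in> E ^^ graph_dist E x y"
proof -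
  have "\<exists>n. (x, y) \<in> E ^^ n"
    using assms unfolding tree_def by (metis rtrancl_imp_relpow)
  then show ?thesis
    unfolding graph_dist_def by (rule LeastI_ex)
qed

lemma graph_dist_le: "(x, y) \<in> E ^^ n \<Longrightarrow> graph_dist E x y \<le> n"
  unfolding graph_dist_def by (rule Least_le)

lemma graph_dist_triangle:
  assumes "tree E"
  shows "graph_dist E x z \<le> graph_dist E x y + graph_dist E y z"
  using relpow_graph_dist[OF assms, of x y] relpow_graph_dist[OF assms, of y z]
  by (intro graph_dist_le) (auto simp: relpow_add)

lemma graph_dist_edge_le:
  assumes "tree E" "(x, y) \<in> E"
  shows "graph_dist E x r \<le> Suc (graph_dist E y r)"
  using relpow_graph_dist[OF assms(1), of y r] assms(2)
  by (intro graph_dist_le) (rule relpow_Suc_I2)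

lemma graph_dist_eq_0:
  assumes "tree E" "graph_dist E x r = 0"
  shows "x = r"
  using relpow_graph_dist[OF assms(1), of x r] assms(2) by simp

lemma ex_closer_neighbour:
  assumes "tree E" "graph_dist E x r = Suc k"
  shows "\<exists>y. (x, y) \<in> E \<and> graph_dist E y r = k"
proof -
  obtain y where y: "(x, y) \<in> E" "(y, r) \<in> E ^^ k"
    using relpow_graph_dist[OF assms(1), of x r] assms(2) by (metis relpow_Suc_D2)
  then show ?thesis
    using graph_dist_edge_le[OF assms(1) y(1), of r] graph_dist_le[OF y(2)] assms(2) by auto
qed

text \<open>
  This is the form in which acyclicity is used. If a path has both ends at distance \<open>k + 1\<close>
  from \<open>r\<close> and never comes closer, step from each end to a neighbour at distance \<open>k\<close>: either the
  two neighbours agree and close a cycle, or they give a longer path of the same kind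
  around a smaller ball. At radius \<open>0\<close> both ends are \<open>r\<close>, which is absurd. Allowing
  the path to touch the sphere of radius \<open>k\<close> in its interior costs nothing and makes a
  single edge inside that sphere a legitimate instance.
\<close>

lemma no_path_outside_ball:
  assumes "tree E"
  shows "2 \<le> length xs \<Longrightarrow> distinct xs \<Longrightarrow> successively (\<lambda>x y. (x, y) \<in> E) xs \<Longrightarrow>
    graph_dist E (hd xs) r = k \<Longrightarrow> graph_dist E (last xs) r = k \<Longrightarrow>
    (\<forall>x\<in>set xs. k \<le> graph_dist E x r) \<Longrightarrow> False"
proof (induction k arbitrary: xs)
  case 0
  have "hd xs = last xs"
    using graph_dist_eq_0[OF assms] 0 by metis
  moreover have "hd xs \<noteq> last xs"
    using 0(1,2) by (cases xs) auto
  ultimately show ?case by simp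
next
  case (Suc k)
  have ne: "xs \<noteq> []" using Suc.prems(1) by auto
  obtain u where u: "(hd xs, u) \<in> E" "graph_dist E u r = k"
    using ex_closer_neighbour[OF assms Suc.prems(4)] by blast
  obtain v where v: "(last xs, v) \<in> E" "graph_dist E v r = k"
    using ex_closer_neighbour[OF assms Suc.prems(5)] by blast
  have notin: "u \<notin> set xs" "v \<notin> set xs"
    using Suc.prems(6) u(2) v(2) by force+
  have uE: "(u, hd xs) \<in> E" using tree_sym[OF assms u(1)] .
  show ?case
  proof (cases "u = v")
    case True
    have "is_cycle E (u # xs)"
      using Suc.prems(1-3) notin uE v(1) ne True
      by (auto simp: is_cycle_def successively_Cons)
    then show False using assms unfolding tree_def by blast
  next
    case False
    let ?ys = "u # xs @ [v]"
    show False
    proof (rule Suc.IH[of ?ys])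
      show "distinct ?ys" using Suc.prems(2) notin False by auto
      show "successively (\<lambda>x y. (x, y) \<in> E) ?ys"
        using Suc.prems(3) uE v(1) ne by (auto simp: successively_Cons successively_append_iff)
      show "\<forall>x\<in>set ?ys. k \<le> graph_dist E x r"
        using Suc.prems(6) u(2) v(2) by (auto intro: Suc_leD)
    qed (use u v in auto)
  qed
qed

lemma graph_dist_neighbour_neq:
  assumes "tree E" "(x, y) \<in> E"
  shows "graph_dist E x r \<noteq> graph_dist E y r"
proof
  assume eq: "graph_dist E x r = graph_dist E y r"
  have "x \<noteq> y" using assms by (auto simp: tree_def simple_graph_def irrefl_def)
  then show False
    using no_path_outside_ball[OF assms(1), of "[x, y]" r "graph_dist E x r"] assms(2) eq by auto
qed

lemma closer_neighbour_unique:
  assumes "tree E" "(x, y) \<in> E" "(x, z) \<in> E"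
    and "Suc (graph_dist E y r) = graph_dist E x r" "Suc (graph_dist E z r) = graph_dist E x r"
  shows "y = z"
proof (rule ccontr)
  assume "y \<noteq> z"
  moreover have "x \<noteq> y" "x \<noteq> z" using assms(4,5) by auto
  ultimately show False
    using no_path_outside_ball[OF assms(1), of "[y, x, z]" r "graph_dist E y r"] assms
      tree_sym[OF assms(1,2)] by auto
qed

section \<open>The level function and the forest of successors\<close>

text \<open>
  Seen from a common vertex \<open>\<xi> N = \<eta> N\<close>, each step of either ray is the unique step that
  brings it closer, so the two rays cannot separate before time \<open>N\<close>. Thus a boundary point is
  a singleton, and \<open>ray\<close> picks a genuine geodesic.
\<close>

lemma geodesic_rays_eventually_coincide_eq:
  assumes "tree E" "\<xi> \<in> geodesic_rays E o'" "\<eta> \<in> geodesic_rays E o'"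
    and "\<forall>\<^sub>F n in sequentially. \<xi> n = \<eta> n"
  shows "\<xi> = \<eta>"
proof
  fix n
  obtain N where N: "\<xi> N = \<eta> N" "n \<le> N"
    using assms(4) unfolding eventually_sequentially by (metis le_cases)
  have *: "i \<le> N \<Longrightarrow> \<xi> i = \<eta> i" for i
  proof (induction i)
    case 0
    then show ?case using assms(2,3) by (auto simp: geodesic_rays_def)
  next
    case (Suc i)
    have edge: "(\<zeta> i, \<zeta> (Suc i)) \<in> E" if "\<zeta> \<in> geodesic_rays E o'" for \<zeta>
    proof -
      have "graph_dist E (\<zeta> i) (\<zeta> (Suc i)) = 1"
        using that by (simp add: geodesic_rays_def)
      then show ?thesis using relpow_graph_dist[OF assms(1), of "\<zeta> i" "\<zeta> (Suc i)"] by simp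
    qed
    have dist: "graph_dist E (\<zeta> j) (\<zeta> N) = N - j" if "\<zeta> \<in> geodesic_rays E o'" "j \<le> N" for \<zeta> j
      using that by (simp add: geodesic_rays_def)
    have eq: "\<xi> i = \<eta> i" using Suc by simp
    show ?case
    proof (rule closer_neighbour_unique[OF assms(1), of "\<xi> i" _ _ "\<xi> N"])
      show "(\<xi> i, \<xi> (Suc i)) \<in> E" by (rule edge[OF assms(2)])
      show "(\<xi> i, \<eta> (Suc i)) \<in> E" using edge[OF assms(3)] eq by simp
      show "Suc (graph_dist E (\<xi> (Suc i)) (\<xi> N)) = graph_dist E (\<xi> i) (\<xi> N)"
        using dist[OF assms(2)] Suc.prems by simp
      show "Suc (graph_dist E (\<eta> (Suc i)) (\<xi> N)) = graph_dist E (\<xi> i) (\<xi> N)"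
        using dist[OF assms(2)] dist[OF assms(3)] Suc.prems N by simp
    qed
  qed
  show "\<xi> n = \<eta> n" using * N by simp
qed

lemma ray_in_geodesic_rays:
  assumes "tree E" "\<omega> \<in> boundary E o'"
  shows "ray \<omega> \<in> geodesic_rays E o'"
proof -
  obtain \<xi> where \<xi>: "\<xi> \<in> geodesic_rays E o'" "\<omega> = eventually_coincide E o' `` {\<xi>}"
    using assms(2) unfolding boundary_def by (rule quotientE)
  have "\<omega> = {\<xi>}"
    using \<xi> geodesic_rays_eventually_coincide_eq[OF assms(1)]
    by (auto simp: eventually_coincide_def)
  then show ?thesis using \<xi>(1) by (simp add: ray_def)
qed

locale tree_with_end =
  fixes E :: "('a \<times> 'a) set" and o' :: 'a and \<omega> :: "(nat \<Rightarrow> 'a) set"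
  assumes tree: "tree E"
    and locally_finite: "locally_finite E"
    and end_in_boundary: "\<omega> \<in> boundary E o'"
begin

text \<open>
  The sequence \<open>n - d(x, \<xi> n)\<close> is nondecreasing, as one step along the ray changes the distance
  by at most one, and it is bounded above by \<open>d(\<xi> 0, x)\<close>. An integer sequence of this kind is
  eventually constant. From here on, statements about levels reduce to statements about
  distances to \<open>\<xi> n\<close> for one large \<open>n\<close>.
\<close>

lemma level_attained:
  "\<forall>\<^sub>F n in sequentially. int (graph_dist E x (ray \<omega> n)) = int n - level E \<omega> x"
proof -
  let ?\<xi> = "ray \<omega>"
  let ?d = "\<lambda>n. graph_dist E x (?\<xi> n)"
  let ?a = "\<lambda>n. int n - int (?d n)"
  have dist: "graph_dist E (?\<xi> i) (?\<xi> j) = j - i" if "i \<le> j" for i j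
    using ray_in_geodesic_rays[OF tree end_in_boundary] that by (simp add: geodesic_rays_def)
  have upper: "?a n \<le> int (graph_dist E (?\<xi> 0) x)" for n
    using graph_dist_triangle[OF tree, of "?\<xi> 0" "?\<xi> n" x] dist[of 0 n] by simp
  have mono: "?a i \<le> ?a j" if "i \<le> j" for i j
    using graph_dist_triangle[OF tree, of x "?\<xi> j" "?\<xi> i"] dist[OF that] that by linarith
  \<comment> \<open>The gap to the upper bound is a natural number, so it attains a minimum.\<close>
  define b where "b = (\<lambda>n. nat (int (graph_dist E (?\<xi> 0) x) - ?a n))"
  obtain N where N: "\<And>n. b N \<le> b n"
    using ex_has_least_nat[of "\<lambda>_. True" 0 b] by auto
  have const: "?a n = ?a N" if "N \<le> n" for n
    using N[of n] mono[OF that] upper[of n] upper[of N] unfolding b_def by linarith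
  then have ev: "\<forall>\<^sub>F n in sequentially. ?a n = ?a N"
    unfolding eventually_sequentially by blast
  then have "?a \<longlonglongrightarrow> ?a N"
    by (rule tendsto_eventually)
  then have "level E \<omega> x = ?a N"
    unfolding level_def by (rule limI)
  with ev show ?thesis
    by (auto elim!: eventually_mono)
qed

lemma level_neighbour:
  assumes "(x, y) \<in> E"
  shows "level E \<omega> y = level E \<omega> x + 1 \<or> level E \<omega> y = level E \<omega> x - 1"
proof -
  have "\<forall>\<^sub>F n in sequentially. level E \<omega> y = level E \<omega> x + 1 \<or> level E \<omega> y = level E \<omega> x - 1"
    using level_attained[of x] level_attained[of y]
  proof eventually_elim
    case (elim n)
    then show ?case
      using graph_dist_edge_le[OF tree assms, of "ray \<omega> n"]
        graph_dist_edge_le[OF tree tree_sym[OF tree assms], of "ray \<omega> n"]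
        graph_dist_neighbour_neq[OF tree assms, of "ray \<omega> n"] by linarith
  qed
  then show ?thesis by simp
qed

text \<open>
  Local finiteness allows a single \<open>n\<close> for which the levels of \<open>x\<close> and of all its neighbours are
  read off from distances to \<open>\<xi> n\<close>. Then a neighbour lies one level up precisely when it is
  closer to \<open>\<xi> n\<close>, and there is exactly one such neighbour as soon as \<open>\<xi> n \<noteq> x\<close>.
\<close>

lemma ex1_predecessor: "\<exists>!y. (x, y) \<in> E \<and> level E \<omega> y = level E \<omega> x + 1"
proof -
  have "finite {y. (x, y) \<in> E}"
    using locally_finite by (simp add: locally_finite_def)
  then have "\<forall>\<^sub>F n in sequentially. \<forall>y\<in>{y. (x, y) \<in> E}.
      int (graph_dist E y (ray \<omega> n)) = int n - level E \<omega> y"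
    by (rule eventually_ball_finite) (intro ballI level_attained)
  \<comment> \<open>This makes the distance from \<open>x\<close> to the ray vertex positive.\<close>
  moreover have "\<forall>\<^sub>F n in sequentially. level E \<omega> x < int n"
    using eventually_gt_at_top[of "nat (level E \<omega> x)"] by eventually_elim auto
  ultimately have "\<forall>\<^sub>F n in sequentially. \<exists>!y. (x, y) \<in> E \<and> level E \<omega> y = level E \<omega> x + 1"
    using level_attained[of x]
  proof eventually_elim
    case (elim n)
    let ?r = "ray \<omega> n"
    have closer: "level E \<omega> y = level E \<omega> x + 1 \<longleftrightarrow> Suc (graph_dist E y ?r) = graph_dist E x ?r"
      if "(x, y) \<in> E" for y
      using elim(1,3) that by fastforce
    have "graph_dist E x ?r \<noteq> 0" using elim(2,3) by simp
    then obtain k where k: "graph_dist E x ?r = Suc k" using not0_implies_Suc by blast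
    obtain y where "(x, y) \<in> E" "graph_dist E y ?r = k"
      using ex_closer_neighbour[OF tree k] by blast
    then show ?case
      using closer closer_neighbour_unique[OF tree] k by metis
  qed
  then show ?thesis by simp
qed

lemma predecessor: "(x, predecessor E \<omega> x) \<in> E" "level E \<omega> (predecessor E \<omega> x) = level E \<omega> x + 1"
  using theI'[OF ex1_predecessor[of x]] unfolding predecessor_def by auto

lemma predecessor_eq:
  "(x, y) \<in> E \<Longrightarrow> level E \<omega> y = level E \<omega> x + 1 \<Longrightarrow> predecessor E \<omega> x = y"
  using ex1_predecessor[of x] predecessor[of x] by auto

text \<open>
  The sets of successors are the fibres of the predecessor map. This is the source of all
  disjointness below.
\<close>

lemma successors_iff: "y \<in> successors E \<omega> x \<longleftrightarrow> predecessor E \<omega> y = x"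
proof
  assume "y \<in> successors E \<omega> x"
  then have y: "(x, y) \<in> E" "y \<noteq> predecessor E \<omega> x"
    by (auto simp: successors_def)
  then have "level E \<omega> y = level E \<omega> x - 1"
    using level_neighbour predecessor_eq by metis
  then show "predecessor E \<omega> y = x"
    using predecessor_eq[of y x] tree_sym[OF tree y(1)] by simp
next
  assume x: "predecessor E \<omega> y = x"
  then have "(x, y) \<in> E" "level E \<omega> x = level E \<omega> y + 1"
    using predecessor[of y] tree_sym[OF tree] by auto
  then show "y \<in> successors E \<omega> x"
    using predecessor(2)[of x] by (auto simp: successors_def)
qed

lemma finite_successors: "finite (successors E \<omega> x)"
  using locally_finite unfolding locally_finite_def successors_def
  by (auto intro: finite_subset[of _ "{y. (x, y) \<in> E}"])

definition generation :: "'a \<Rightarrow> nat \<Rightarrow> 'a set" where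
  "generation x n = {y. (predecessor E \<omega> ^^ n) y = x}"

lemma generation_0: "generation x 0 = {x}"
  by (auto simp: generation_def)

lemma generation_Suc: "generation x (Suc n) = (\<Union>y\<in>generation x n. successors E \<omega> y)"
  by (auto simp: generation_def successors_iff funpow_swap1)

lemma finite_generation: "finite (generation x n)"
  by (induction n) (auto simp: generation_0 generation_Suc finite_successors)

lemma level_generation: "y \<in> generation x n \<Longrightarrow> level E \<omega> y = level E \<omega> x - int n"
proof (induction n arbitrary: y)
  case (Suc n)
  then have "predecessor E \<omega> y \<in> generation x n"
    by (auto simp: generation_Suc successors_iff)
  then show ?case
    using Suc.IH predecessor(2)[of y] by simp
qed (simp add: generation_0)

lemma sum_generation_Suc:
  fixes h :: "'a \<Rightarrow> 'b::comm_monoid_add"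
  shows "(\<Sum>z\<in>generation x (Suc n). h z) = (\<Sum>y\<in>generation x n. \<Sum>z\<in>successors E \<omega> y. h z)"
  unfolding generation_Suc
  by (rule sum.UNION_disjoint) (auto simp: finite_generation finite_successors successors_iff)

lemma generation_sum_mono:
  fixes h :: "'a \<Rightarrow> real"
  assumes "\<And>y. h y \<le> (\<Sum>z\<in>successors E \<omega> y. h z)"
  shows "h x \<le> (\<Sum>z\<in>generation x n. h z)"
proof (induction n)
  case (Suc n)
  also have "(\<Sum>z\<in>generation x n. h z) \<le> (\<Sum>z\<in>generation x (Suc n). h z)"
    unfolding sum_generation_Suc by (intro sum_mono assms)
  finally show ?case .
qed (simp add: generation_0)

text \<open>
  Each of the first \<open>N\<close> generations of \<open>x\<close> carries \<open>h\<close>-mass at least \<open>h x\<close>; being on different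
  levels, they contribute separately to the total weighted mass.
\<close>

lemma weighted_generations_le_infsum:
  fixes h :: "'a \<Rightarrow> real" and \<sigma> :: "int \<Rightarrow> real"
  assumes sub: "\<And>y. h y \<le> (\<Sum>z\<in>successors E \<omega> y. h z)"
    and nonneg: "\<And>y. 0 \<le> h y" "\<And>n. 0 \<le> \<sigma> n"
    and summable: "(\<lambda>y. \<sigma> (level E \<omega> y) * h y) summable_on UNIV"
  shows "(\<Sum>n<N. \<sigma> (level E \<omega> x - int n)) * h x \<le> (\<Sum>\<^sub>\<infinity>y. \<sigma> (level E \<omega> y) * h y)"
proof -
  let ?H = "\<lambda>y. \<sigma> (level E \<omega> y) * h y"
  have "(\<Sum>n<N. \<sigma> (level E \<omega> x - int n)) * h x
      \<le> (\<Sum>n<N. \<sigma> (level E \<omega> x - int n) * (\<Sum>y\<in>generation x n. h y))"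
    unfolding sum_distrib_right
    by (intro sum_mono mult_left_mono generation_sum_mono sub nonneg)
  also have "\<dots> = (\<Sum>n<N. \<Sum>y\<in>generation x n. ?H y)"
    unfolding sum_distrib_left by (intro sum.cong refl) (simp add: level_generation)
  also have "\<dots> = (\<Sum>y\<in>(\<Union>n<N. generation x n). ?H y)"
    by (rule sum.UNION_disjoint[symmetric])
       (auto simp: finite_generation dest!: level_generation)
  also have "\<dots> \<le> (\<Sum>\<^sub>\<infinity>y. ?H y)"
    using summable by (intro finite_sum_le_infsum) (auto simp: finite_generation nonneg)
  finally show ?thesis .
qed

end

section \<open>Convexity and integrability\<close>

text \<open>
  The modulus of a function may vanish, so convexity is needed on the closed half-line. At an
  endpoint \<open>0\<close> it amounts to \<open>t powr p \<le> t\<close> for \<open>0 < t < 1\<close>.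
\<close>

lemma convex_on_powr_nonneg:
  fixes p :: real
  assumes "1 \<le> p"
  shows "convex_on {0..} (\<lambda>x::real. x powr p)"
proof (rule convex_on_linorderI)
  fix t x y :: real
  assume t: "0 < t" "t < 1" and xy: "x \<in> {0..}" "y \<in> {0..}" "x < y"
  show "((1 - t) *\<^sub>R x + t *\<^sub>R y) powr p \<le> (1 - t) * x powr p + t * y powr p"
  proof (cases "x = 0")
    case True
    have "t powr p \<le> t powr 1" using t assms by (intro powr_mono') auto
    then show ?thesis
      using True t xy assms by (simp add: powr_mult mult_right_mono)
  next
    case False
    then show ?thesis
      using convex_onD[OF powr_convex[OF assms], of t x y] t xy by simp
  qed
qed simp

lemma norm_weighted_mean_powr_le:
  fixes f :: "'b \<Rightarrow> 'c::real_normed_vector" and a :: "'b \<Rightarrow> real"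
  assumes "finite S" "\<And>i. i \<in> S \<Longrightarrow> 0 \<le> a i" "(\<Sum>i\<in>S. a i) = 1" "1 \<le> p"
  shows "norm (\<Sum>i\<in>S. a i *\<^sub>R f i) powr p \<le> (\<Sum>i\<in>S. a i * norm (f i) powr p)"
proof -
  have "norm (\<Sum>i\<in>S. a i *\<^sub>R f i) \<le> (\<Sum>i\<in>S. a i *\<^sub>R norm (f i))"
    using assms(2) by (intro sum_norm_le) auto
  then have "norm (\<Sum>i\<in>S. a i *\<^sub>R f i) powr p \<le> (\<Sum>i\<in>S. a i *\<^sub>R norm (f i)) powr p"
    using assms(4) by (intro powr_mono2) auto
  also have "\<dots> \<le> (\<Sum>i\<in>S. a i * norm (f i) powr p)"
    using assms by (intro convex_on_sum[OF _ _ convex_on_powr_nonneg]) auto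
  finally show ?thesis .
qed

text \<open>
  The flow condition makes the numbers \<open>m y / m x\<close>, for \<open>y\<close> a successor of \<open>x\<close>, a probability
  vector, so Jensen's inequality applies to the harmonicity equation.
\<close>

lemma harmonic_norm_powr_submean:
  assumes "flow_measure E \<omega> m" "harmonic E \<omega> m f" "finite (successors E \<omega> x)" "1 \<le> p"
  shows "m x * norm (f x) powr p \<le> (\<Sum>y\<in>successors E \<omega> x. m y * norm (f y) powr p)"
proof -
  let ?S = "successors E \<omega> x"
  have pos: "m y > 0" for y using assms(1) unfolding flow_measure_def by blast
  have mass: "(\<Sum>y\<in>?S. m y) = m x" using assms(1) unfolding flow_measure_def by metis
  have "f x = (\<Sum>y\<in>?S. (m y / m x) *\<^sub>R f y)"
  proof -
    have "laplacian E \<omega> m f x = 0" using assms(2) unfolding harmonic_def by blast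
    then have "f x = (\<Sum>y\<in>?S. f y * of_real (m y / m x))"
      unfolding laplacian_def by (rule right_minus_eq[THEN iffD1])
    also have "\<dots> = (\<Sum>y\<in>?S. (m y / m x) *\<^sub>R f y)"
      by (intro sum.cong refl) (simp add: scaleR_conv_of_real mult.commute)
    finally show ?thesis .
  qed
  moreover have "(\<Sum>y\<in>?S. m y / m x) = 1"
    using mass pos[of x] by (simp flip: sum_divide_distrib)
  ultimately have "norm (f x) powr p \<le> (\<Sum>y\<in>?S. (m y / m x) * norm (f y) powr p)"
    using norm_weighted_mean_powr_le[of ?S "\<lambda>y. m y / m x" p f] assms(3,4) pos
    by (simp add: less_imp_le)
  then have "m x * norm (f x) powr p \<le> m x * (\<Sum>y\<in>?S. (m y / m x) * norm (f y) powr p)"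
    using pos[of x] by (intro mult_left_mono) auto
  also have "\<dots> = (\<Sum>y\<in>?S. m y * norm (f y) powr p)"
    using pos[of x] by (simp add: sum_distrib_left)
  finally show ?thesis .
qed

lemma Lp_weighted_measure_summable:
  assumes "f \<in> Lp p (weighted_measure E \<omega> m \<sigma>)"
    and "\<And>x. 0 \<le> m x" "\<And>n. 0 \<le> \<sigma> n"
  shows "(\<lambda>x. m x * \<sigma> (level E \<omega> x) * norm (f x) powr p) summable_on UNIV"
proof -
  have "integrable (count_space UNIV) (\<lambda>x. m x * \<sigma> (level E \<omega> x) * norm (f x) powr p)"
    using assms integrable_density[of "\<lambda>x. norm (f x) powr p" "count_space UNIV"
        "\<lambda>x. m x * \<sigma> (level E \<omega> x)"]
    by (simp add: Lp_def weighted_measure_def point_measure_def)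
  then have "Infinite_Set_Sum.abs_summable_on
      (\<lambda>x. m x * \<sigma> (level E \<omega> x) * norm (f x) powr p) UNIV"
    by (simp add: Infinite_Set_Sum.abs_summable_on_def)
  then show ?thesis
    by (rule abs_summable_summable[OF abs_summable_equivalent[THEN iffD2]])
qed

text \<open>
  Summing downwards from an arbitrary level \<open>l\<close> instead of \<open>0\<close> does not affect convergence: for
  \<open>l < 0\<close> only the finitely many terms in \<open>{l<..0}\<close> are missed.
\<close>

lemma infsum_nonpos_ints_finite:
  fixes \<sigma> :: "int \<Rightarrow> real"
  assumes nonneg: "\<And>n. 0 \<le> \<sigma> n" and bound: "\<And>N. (\<Sum>n<N. \<sigma> (l - int n)) \<le> C"
  shows "(\<Sum>\<^sub>\<infinity>n\<in>{..0}. ennreal (\<sigma> n)) < \<infinity>"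
proof -
  let ?D = "\<Sum>k\<in>{l<..0}. \<sigma> k"
  have "(\<Sum>\<^sub>\<infinity>n\<in>{..0}. ennreal (\<sigma> n)) \<le> ennreal (C + ?D)"
  proof (rule infsum_le_finite_sums)
    fix F :: "int set" assume F: "finite F" "F \<subseteq> {..0}"
    obtain b where b: "\<And>k. k \<in> F \<Longrightarrow> b \<le> k"
      using F(1) by (meson bdd_below_finite bdd_below.E)
    let ?G = "(\<lambda>n. l - int n) ` {..<Suc (nat (l - b))}"
    have "F \<subseteq> ?G \<union> {l<..0}"
    proof
      fix k assume k: "k \<in> F"
      show "k \<in> ?G \<union> {l<..0}"
      proof (cases "k \<le> l")
        case True
        then have "k = l - int (nat (l - k))" "nat (l - k) < Suc (nat (l - b))"
          using b[OF k] by auto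
        then show ?thesis by blast
      qed (use k F in auto)
    qed
    then have "sum \<sigma> F \<le> sum \<sigma> (?G \<union> {l<..0})"
      by (intro sum_mono2) (auto simp: nonneg)
    also have "\<dots> = sum \<sigma> ?G + ?D"
      by (intro sum.union_disjoint) auto
    also have "sum \<sigma> ?G = (\<Sum>n<Suc (nat (l - b)). \<sigma> (l - int n))"
      by (subst sum.reindex) (auto simp: inj_on_def)
    also have "\<dots> \<le> C" by (rule bound)
    finally show "(\<Sum>n\<in>F. ennreal (\<sigma> n)) \<le> ennreal (C + ?D)"
      using nonneg by (simp add: sum_ennreal ennreal_leI)
  qed (rule nonneg_summable_on_complete, simp)
  also have "\<dots> < \<infinity>" by simp
  finally show ?thesis .
qed

section \<open>The Liouville property\<close>

theorem proposition2p4: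
  fixes E :: "('a \<times> 'a) set" and o' :: 'a and \<omega> :: "(nat \<Rightarrow> 'a) set"
    and m :: "'a \<Rightarrow> real" and \<sigma> :: "int \<Rightarrow> real" and f :: "'a \<Rightarrow> complex" and p :: real
  assumes "infinite (UNIV :: 'a set)"
    and "tree E"
    and "locally_finite E"
    and "\<omega> \<in> boundary E o'"
    and "\<And>x. successors E \<omega> x \<noteq> {}"
    and "flow_measure E \<omega> m"
    and "\<And>n. \<sigma> n > 0"
    and "(\<Sum>\<^sub>\<infinity>n\<in>{..0}. ennreal (\<sigma> n)) = \<infinity>"
    and "harmonic E \<omega> m f"
    and "1 \<le> p"
    and "f \<in> Lp p (weighted_measure E \<omega> m \<sigma>)"
  shows "f = (\<lambda>x. 0)"
proof (rule ext, rule ccontr)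
  fix x assume x: "f x \<noteq> 0"
  interpret tree_with_end E o' \<omega>
    using assms(2-4) by unfold_locales
  define h where "h = (\<lambda>y. m y * norm (f y) powr p)"
  let ?B = "\<Sum>\<^sub>\<infinity>y. \<sigma> (level E \<omega> y) * h y"
  have m: "m y > 0" for y using assms(6) unfolding flow_measure_def by blast
  have \<sigma>: "0 \<le> \<sigma> n" for n using assms(7)[of n] by simp
  have "(\<lambda>y. \<sigma> (level E \<omega> y) * h y) summable_on UNIV"
    using Lp_weighted_measure_summable[OF assms(11)] m \<sigma>
    by (simp add: h_def less_imp_le mult_ac)
  then have "(\<Sum>n<N. \<sigma> (level E \<omega> x - int n)) * h x \<le> ?B" for N
    using harmonic_norm_powr_submean[OF assms(6,9) finite_successors assms(10)] m \<sigma>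
    by (intro weighted_generations_le_infsum) (auto simp: h_def less_imp_le)
  moreover have "h x > 0" using x m by (simp add: h_def)
  ultimately have "(\<Sum>n<N. \<sigma> (level E \<omega> x - int n)) \<le> ?B / h x" for N
    by (simp add: pos_le_divide_eq)
  then show False
    using infsum_nonpos_ints_finite[of \<sigma>] \<sigma> assms(8) by fastforce
qed

end
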